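(* Let $m\in[n]$ and $U\subseteq\binom{[n]}{m}$; let $\lambda$ be a real number with $1\ll\lambda\ll \frac{n}{m^2}$; let $\epsilon\in(0,1)$ be a sufficiently small constant; and let $l\in[n]$ satisfy $l>m^2\lambda/\epsilon$. Then there exists an $(l,\lambda)$-extension generator $g$ of $U$ with $|g|\le \kappa(U)\big/\ln\frac{\epsilon l}{m^2\lambda}$.
   Context: Asymptotic convention: $n\to\infty$ and all quantities ($m,l,\lambda,U,\dots$) are functions of $n$; a constant is a positive real independent of $n$; $f\ll g$ means $f/g\to 0$. $[n]=\{1,\dots,n\}$ and $\binom{X}{m}$ is the family of $m$-element subsets of $X$. For nonempty $U\subseteq\binom{[n]}{m}$ its sparsity is $\kappa(U)=\ln\binom{n}{m}-\ln|U|$. For $l\in[n]$, the $l$-extension of $U$ is $Ext(U,l)=\{t\in\binom{[n]}{l}:\exists s\in U,\ s\subseteq t\}$. For $g\subset[n]$ let $U_g=\{s\in U: s\supseteq g\}$. For $l\in[n]\setminus[m]$ and real $\lambda\ge 0$, a set $g\subset[n]$ is an $(l,\lambda)$-extension generator of $U$ if $|Ext(U_g,l)|\ge\binom{n-|g|}{l-|g|}(1-e^{-\lambda})$. *)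

theory Defs
  imports Complex_Main
begin

definition msubsets :: "nat \<Rightarrow> nat \<Rightarrow> nat set set" where
  "msubsets n m = {s. s \<subseteq> {1..n} \<and> card s = m}"

definition much_less :: "(nat \<Rightarrow> real) \<Rightarrow> (nat \<Rightarrow> real) \<Rightarrow> bool" where
  "much_less f g \<longleftrightarrow> (\<lambda>n. f n / g n) \<longlonglongrightarrow> 0"

text \<open>Meaningful only for nonempty \<open>U \<subseteq> msubsets n m\<close>; note that \<open>ln 0 = 0\<close>.\<close>

definition sparsity :: "nat \<Rightarrow> nat \<Rightarrow> nat set set \<Rightarrow> real" where
  "sparsity n m U = ln (real (n choose m)) - ln (real (card U))"

definition Ext :: "nat \<Rightarrow> nat set set \<Rightarrow> nat \<Rightarrow> nat set set" where
  "Ext n U l = {t \<in> msubsets n l. \<exists>s\<in>U. s \<subseteq> t}"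

definition containing :: "nat set set \<Rightarrow> nat set \<Rightarrow> nat set set" where
  "containing U g = {s \<in> U. g \<subseteq> s}"

text \<open>
  The side conditions on \<open>l\<close> and \<open>lam\<close> under which the notion is introduced are part of the
  definition. The subtractions are on \<open>nat\<close>: for \<open>card g > l\<close> the binomial coefficient is 1 rather
  than 0, so that no such \<open>g\<close> is a generator for \<open>lam > 0\<close> and \<open>U \<subseteq> msubsets n m\<close>.
\<close>

definition ext_generator ::
  "nat \<Rightarrow> nat \<Rightarrow> nat set set \<Rightarrow> nat \<Rightarrow> real \<Rightarrow> nat set \<Rightarrow> bool" where
  "ext_generator n m U l lam g \<longleftrightarrow>
     l \<in> {1..n} - {1..m} \<and> 0 \<le> lam \<and> g \<subseteq> {1..n} \<and>
     real (card (Ext n (containing U g) l))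
       \<ge> real ((n - card g) choose (l - card g)) * (1 - exp (- lam))"

end

theory Submission
  imports Defs "HOL-Library.FuncSet"
begin

text \<open>
  Put \<open>b = \<epsilon> l / (m\<^sup>2 \<lambda>)\<close> and take \<open>g\<close> of maximal size such that passing to the link of \<open>g\<close>
  multiplies the density of \<open>U\<close> by at least \<open>b ^ card g\<close>. Densities are at most 1, whence the
  bound on \<open>card g\<close>; by maximality the link \<open>V\<close> is spread. By the second moment method, a
  random set of about \<open>l / (2 \<lambda>)\<close> points then misses every member of \<open>V\<close> with probability at
  most \<open>1 / e\<close>. Missing \<open>V\<close> is a decreasing property, and for such properties the density on
  the layers is submultiplicative, so a random \<open>l\<close>-set, which is at least as large as the union
  of \<open>\<lambda>\<close> independent such sets, misses \<open>V\<close> with probability at most \<open>exp (- \<lambda>)\<close>.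
\<close>

section \<open>Layers of the subset lattice and densities on them\<close>

definition layer :: "'a set \<Rightarrow> nat \<Rightarrow> 'a set set" where
  "layer X k = {T. T \<subseteq> X \<and> card T = k}"

definition density :: "'a set \<Rightarrow> ('a set \<Rightarrow> bool) \<Rightarrow> nat \<Rightarrow> real" where
  "density X P k = real (card {T \<in> layer X k. P T}) / real (card X choose k)"

lemma finite_layer [simp]: "finite X \<Longrightarrow> finite (layer X k)"
  unfolding layer_def by (rule finite_subset[of _ "Pow X"]) auto

lemma card_layer: "finite X \<Longrightarrow> card (layer X k) = card X choose k"
  unfolding layer_def by (rule n_subsets)

lemma density_nonneg: "0 \<le> density X P k"
  by (simp add: density_def)

lemma card_layer_superset:
  assumes "finite X" "A \<subseteq> X" "card A \<le> k"
  shows "card {T \<in> layer X k. A \<subseteq> T} = (card X - card A) choose (k - card A)"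
proof -
  have fA: "finite A" using assms finite_subset by blast
  have "bij_betw (\<lambda>C. A \<union> C) (layer (X - A) (k - card A)) {T \<in> layer X k. A \<subseteq> T}"
  proof (rule bij_betwI[where g = "\<lambda>T. T - A"])
    show "(\<lambda>C. A \<union> C) \<in> layer (X - A) (k - card A) \<rightarrow> {T \<in> layer X k. A \<subseteq> T}"
    proof
      fix C assume C: "C \<in> layer (X - A) (k - card A)"
      then have "finite C" "A \<inter> C = {}"
        using assms(1) by (auto simp: layer_def intro: finite_subset)
      then have "card (A \<union> C) = k"
        using C assms(3) fA by (simp add: card_Un_disjoint layer_def)
      then show "A \<union> C \<in> {T \<in> layer X k. A \<subseteq> T}"
        using C assms(2) by (auto simp: layer_def)
    qed
    show "(\<lambda>T. T - A) \<in> {T \<in> layer X k. A \<subseteq> T} \<rightarrow> layer (X - A) (k - card A)"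
      using fA by (auto simp: layer_def card_Diff_subset)
  qed (auto simp: layer_def)
  then have "card {T \<in> layer X k. A \<subseteq> T} = card (layer (X - A) (k - card A))"
    by (simp add: bij_betw_same_card)
  also have "\<dots> = (card X - card A) choose (k - card A)"
    using assms fA by (simp add: card_layer card_Diff_subset)
  finally show ?thesis .
qed

text \<open>Double counting of the pairs \<open>S \<subseteq> T\<close> between the two layers, as
  in the local LYM inequality: all \<open>k choose j\<close> subsets of a good \<open>T\<close> are
  good, while a good \<open>S\<close> lies in at most \<open>(card X - j) choose (k - j)\<close>
  good sets. The identity \<open>choose_mult\<close> turns these two numbers into the ratio of the
  layer sizes.\<close>

lemma density_antimono:
  assumes X: "finite X" and down: "\<And>S T. S \<subseteq> T \<Longrightarrow> P T \<Longrightarrow> P S"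
    and "j \<le> k" "k \<le> card X"
  shows "density X P k \<le> density X P j"
proof -
  let ?F = "\<lambda>i. {T \<in> layer X i. P T}"
  have fin: "finite (?F i)" for i using X by simp
  have "card (?F k) * (k choose j) = (\<Sum>T\<in>?F k. card {S \<in> ?F j. S \<subseteq> T})"
  proof -
    have "card {S \<in> ?F j. S \<subseteq> T} = k choose j" if T: "T \<in> ?F k" for T
    proof -
      have "{S \<in> ?F j. S \<subseteq> T} = layer T j"
        using T down by (auto simp: layer_def)
      moreover have "finite T" using T X by (auto simp: layer_def intro: finite_subset)
      ultimately have "card {S \<in> ?F j. S \<subseteq> T} = card T choose j" by (simp add: card_layer)
      then show ?thesis using T by (simp add: layer_def)
    qed
    then show ?thesis by simp
  qed
  also have "\<dots> = (\<Sum>S\<in>?F j. card {T \<in> ?F k. S \<subseteq> T})"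
    using sum_multicount_gen[OF fin[of k] fin[of j], of "\<lambda>T S. S \<subseteq> T"
        "\<lambda>S. card {T \<in> ?F k. S \<subseteq> T}"] by simp
  also have "\<dots> \<le> (\<Sum>S\<in>?F j. (card X - j) choose (k - j))"
  proof (rule sum_mono)
    fix S assume S: "S \<in> ?F j"
    have "card {T \<in> ?F k. S \<subseteq> T} \<le> card {T \<in> layer X k. S \<subseteq> T}"
      using X by (intro card_mono) auto
    also have "\<dots> = (card X - j) choose (k - j)"
      using card_layer_superset[OF X, of S k] S assms(3) by (simp add: layer_def)
    finally show "card {T \<in> ?F k. S \<subseteq> T} \<le> (card X - j) choose (k - j)" .
  qed
  finally have 1: "card (?F k) * (k choose j) \<le> card (?F j) * ((card X - j) choose (k - j))"
    by simp
  have 2: "(card X choose k) * (k choose j) = (card X choose j) * ((card X - j) choose (k - j))"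
    using assms by (intro choose_mult)
  have pos: "0 < k choose j" "0 < card X choose k" "0 < card X choose j"
    using assms by simp_all
  have "card (?F k) * (card X choose j) * (k choose j)
      \<le> card (?F j) * ((card X choose j) * ((card X - j) choose (k - j)))"
    using mult_right_mono[OF 1, of "card X choose j"] by (simp add: mult_ac)
  also have "\<dots> = card (?F j) * (card X choose k) * (k choose j)"
    by (simp flip: 2)
  finally have "card (?F k) * (card X choose j) \<le> card (?F j) * (card X choose k)"
    using pos by simp
  then have "real (card (?F k)) * real (card X choose j)
      \<le> real (card (?F j)) * real (card X choose k)"
    by (simp only: of_nat_mult[symmetric] of_nat_le_iff)
  then show ?thesis
    using pos by (simp add: density_def field_simps)
qed

section \<open>Unions of two random sets and submultiplicativity\<close>

definition covering_pairs :: "nat \<Rightarrow> nat \<Rightarrow> 'a set \<Rightarrow> ('a set \<times> 'a set) set" where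
  "covering_pairs a b S = {(A, B). A \<union> B = S \<and> card A = a \<and> card B = b}"

lemma finite_covering_pairs: "finite S \<Longrightarrow> finite (covering_pairs a b S)"
  by (rule finite_subset[of _ "Pow S \<times> Pow S"]) (auto simp: covering_pairs_def)

text \<open>A bijection of the points acts injectively on pairs of subsets and respects sizes and
  unions. Applied to the inverse bijection as well, this yields equality for sets of equal
  size.\<close>

lemma card_covering_pairs_le:
  assumes "finite T" "bij_betw f S T"
  shows "card (covering_pairs a b S) \<le> card (covering_pairs a b T)"
proof (rule card_inj_on_le)
  have inj: "inj_on f S" and img: "f ` S = T" using assms(2) by (auto simp: bij_betw_def)
  have Pow_inj: "inj_on ((`) f) (Pow S)"
    using inj by (rule inj_on_image_Pow)
  show "inj_on (map_prod ((`) f) ((`) f)) (covering_pairs a b S)"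
    by (rule inj_on_subset[OF map_prod_inj_on[OF Pow_inj Pow_inj]]) (auto simp: covering_pairs_def)
  show "map_prod ((`) f) ((`) f) ` covering_pairs a b S \<subseteq> covering_pairs a b T"
  proof (rule image_subsetI)
    fix p assume "p \<in> covering_pairs a b S"
    then obtain A B where AB: "p = (A, B)" "A \<union> B = S" "card A = a" "card B = b"
      by (auto simp: covering_pairs_def)
    have "card (f ` A) = a" "card (f ` B) = b"
      using inj AB by (auto intro!: card_image simp flip: AB(3,4) intro: inj_on_subset)
    moreover have "f ` A \<union> f ` B = T" using AB img by blast
    ultimately show "map_prod ((`) f) ((`) f) p \<in> covering_pairs a b T"
      by (simp add: AB(1) covering_pairs_def)
  qed
qed (rule finite_covering_pairs[OF assms(1)])

lemma card_covering_pairs_cong: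
  assumes "finite S" "finite T" "card S = card T"
  shows "card (covering_pairs a b S) = card (covering_pairs a b T)"
proof -
  obtain f where "bij_betw f S T"
    using finite_same_card_bij[OF assms] by blast
  then show ?thesis
    using assms by (meson card_covering_pairs_le bij_betw_inv_into le_antisym)
qed

text \<open>
  If \<open>A\<close> and \<open>B\<close> are independent and uniform on their layers, then \<open>A \<union> B\<close> is, by symmetry,
  uniform given its size, which is at most \<open>a + b\<close>.
\<close>

lemma density_add_le:
  assumes X: "finite X" and down: "\<And>S T. S \<subseteq> T \<Longrightarrow> P T \<Longrightarrow> P S"
    and ab: "a + b \<le> card X"
  shows "density X P (a + b) \<le> density X P a * density X P b"
proof -
  \<comment> \<open>The weight of layer \<open>k\<close>: by symmetry any representative gives the
    same number, so an arbitrary one is chosen.\<close>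
  define c where "c k = card (covering_pairs a b (SOME T. T \<in> layer X k))" for k
  have c: "card (covering_pairs a b T) = c (card T)" if "T \<subseteq> X" for T
  proof -
    have "T \<in> layer X (card T)" using that by (simp add: layer_def)
    then have "(SOME S. S \<in> layer X (card T)) \<in> layer X (card T)" by (rule someI)
    then show ?thesis unfolding c_def using that X
      by (intro card_covering_pairs_cong) (auto simp: layer_def intro: finite_subset)
  qed
  \<comment> \<open>Pairs are sorted by their union, and unions by size. The property
    \<open>Q\<close> is kept general because the trivial one gives the total number of pairs with
    the same weights \<open>c k\<close>.\<close>
  have split: "card {(A, B). A \<in> layer X a \<and> B \<in> layer X b \<and> Q (A \<union> B)}
      = (\<Sum>k\<le>a + b. c k * card {T \<in> layer X k. Q T})" for Q
  proof -
    let ?S = "\<lambda>k. {T \<in> layer X k. Q T}"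
    have "{(A, B). A \<in> layer X a \<and> B \<in> layer X b \<and> Q (A \<union> B)}
        = (\<Union>k\<in>{..a + b}. \<Union>T\<in>?S k. covering_pairs a b T)" (is "?L = ?R")
    proof (intro equalityI subsetI)
      fix p assume "p \<in> ?L"
      then obtain A B where p: "p = (A, B)" "A \<in> layer X a" "B \<in> layer X b" "Q (A \<union> B)" by auto
      then have "card (A \<union> B) \<le> a + b" using card_Un_le[of A B] by (simp add: layer_def)
      then show "p \<in> ?R" using p by (auto simp: layer_def covering_pairs_def)
    qed (auto simp: layer_def covering_pairs_def)
    also have "card \<dots> = (\<Sum>k\<in>{..a + b}. card (\<Union>T\<in>?S k. covering_pairs a b T))"
      using X by (intro card_UN_disjoint)
        (auto simp: layer_def covering_pairs_def
          intro!: finite_covering_pairs[unfolded covering_pairs_def] intro: finite_subset)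
    also have "\<dots> = (\<Sum>k\<in>{..a + b}. \<Sum>T\<in>?S k. card (covering_pairs a b T))"
    proof (intro sum.cong refl card_UN_disjoint)
      fix k show "finite (?S k)" using X by simp
      show "\<forall>T\<in>?S k. finite (covering_pairs a b T)"
        using X by (auto simp: layer_def intro!: finite_covering_pairs intro: finite_subset)
    qed (auto simp: covering_pairs_def)
    also have "\<dots> = (\<Sum>k\<in>{..a + b}. \<Sum>T\<in>?S k. c k)"
      using c by (intro sum.cong refl) (auto simp: layer_def)
    finally show ?thesis by (simp add: mult.commute)
  qed
  let ?N = "card X"
  let ?F = "\<lambda>k. {T \<in> layer X k. P T}"
  have total: "(?N choose a) * (?N choose b) = (\<Sum>k\<le>a + b. c k * (?N choose k))"
    using split[of "\<lambda>_. True"] X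
    by (simp add: card_layer card_cartesian_product[symmetric] Sigma_def flip: card_layer)
  have "density X P (a + b) * (real (?N choose a) * real (?N choose b))
      = (\<Sum>k\<le>a + b. real (c k) * (real (?N choose k) * density X P (a + b)))"
    unfolding of_nat_mult[symmetric] total by (simp add: sum_distrib_left mult_ac)
  \<comment> \<open>Overlap only makes the union smaller, and lower layers are at least as
    dense.\<close>
  also have "\<dots> \<le> (\<Sum>k\<le>a + b. real (c k) * (real (?N choose k) * density X P k))"
    using ab by (intro sum_mono mult_left_mono density_antimono[OF X down]) auto
  also have "\<dots> = (\<Sum>k\<le>a + b. real (c k) * real (card (?F k)))"
    using ab by (intro sum.cong refl) (simp add: density_def)
  also have "\<dots> = real (card {(A, B). A \<in> layer X a \<and> B \<in> layer X b \<and> P (A \<union> B)})"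
    by (simp add: split)
  also have "\<dots> \<le> real (card (?F a \<times> ?F b))"
  proof -
    have "{(A, B). A \<in> layer X a \<and> B \<in> layer X b \<and> P (A \<union> B)} \<subseteq> ?F a \<times> ?F b"
      using down[OF Un_upper1] down[OF Un_upper2] by blast
    then show ?thesis using X by (intro of_nat_mono card_mono) auto
  qed
  also have "\<dots> = (density X P a * density X P b) * (real (?N choose a) * real (?N choose b))"
    using ab by (simp add: density_def card_cartesian_product)
  finally show ?thesis
    using ab by (simp add: mult_le_cancel_right)
qed

lemma density_mult_le_power:
  assumes X: "finite X" and down: "\<And>S T. S \<subseteq> T \<Longrightarrow> P T \<Longrightarrow> P S"
    and "q * d \<le> card X"
  shows "density X P (q * d) \<le> density X P d ^ q"
  using assms(3)
proof (induction q)
  case 0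
  have "card {T \<in> layer X 0. P T} \<le> card (layer X 0)"
    using X by (intro card_mono) auto
  then show ?case using X by (simp add: density_def card_layer)
next
  case (Suc q)
  have "density X P (d + q * d) \<le> density X P d * density X P (q * d)"
    using Suc.prems by (intro density_add_le[OF X down]) auto
  also have "\<dots> \<le> density X P d * density X P d ^ q"
    using Suc by (intro mult_left_mono density_nonneg) auto
  finally show ?case by simp
qed

section \<open>Containment probabilities in sampling without replacement\<close>

text \<open>The probability that a uniform \<open>d\<close>-subset of an \<open>N\<close>-set contains a given \<open>j\<close>-set.\<close>

definition hit :: "nat \<Rightarrow> nat \<Rightarrow> nat \<Rightarrow> real" where
  "hit N d j = (\<Prod>i<j. (real d - real i) / (real N - real i))"

lemma choose_diff_eq_hit:
  assumes "j \<le> d" "d \<le> N"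
  shows "real ((N - j) choose (d - j)) = real (N choose d) * hit N d j"
  using assms(1)
proof (induction j)
  case 0
  then show ?case by (simp add: hit_def)
next
  case (Suc j)
  define n k where "n = N - Suc j" and "k = d - Suc j"
  have eq: "N - j = Suc n" "d - j = Suc k"
    using Suc.prems assms(2) by (auto simp: n_def k_def)
  have re: "real N - real j = real (Suc n)" "real d - real j = real (Suc k)"
    using Suc.prems assms(2) by (auto simp: n_def k_def)
  have "real (Suc k) * real (Suc n choose Suc k) = real (Suc n) * real (n choose k)"
    by (simp only: of_nat_mult[symmetric] Suc_times_binomial)
  then have "real (n choose k) = real (Suc n choose Suc k) * (real (Suc k) / real (Suc n))"
    by (simp add: field_simps del: of_nat_Suc binomial_Suc_Suc)
  also have "real (Suc n choose Suc k) = real (N choose d) * hit N d j"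
    using Suc by (simp add: eq del: binomial_Suc_Suc)
  finally show ?case
    by (simp add: hit_def re n_def k_def del: of_nat_Suc)
qed

lemma hit_nonneg: "j \<le> d \<Longrightarrow> d \<le> N \<Longrightarrow> 0 \<le> hit N d j"
  unfolding hit_def by (intro prod_nonneg) auto

lemma hit_pos: "j \<le> d \<Longrightarrow> d \<le> N \<Longrightarrow> 0 < hit N d j"
  unfolding hit_def by (intro prod_pos) auto

text \<open>Each point already caught makes the next one less likely to be caught. The upper bounds
  on \<open>hit\<close> rest on this negative correlation.\<close>

lemma hit_factor_antimono:
  assumes "i \<le> j" "j < d" "d \<le> N"
  shows "(real d - real j) / (real N - real j) \<le> (real d - real i) / (real N - real i)"
proof -
  have "(real d - real j) * (real N - real i) \<le> (real d - real i) * (real N - real j)"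
    using mult_nonneg_nonneg[of "real j - real i" "real N - real d"] assms
    by (simp add: algebra_simps)
  then show ?thesis using assms by (simp add: field_simps)
qed

lemma hit_le_power:
  assumes "j \<le> d" "d \<le> N"
  shows "hit N d j \<le> (real d / real N) ^ j"
proof -
  have "hit N d j \<le> (\<Prod>i<j. real d / real N)"
    unfolding hit_def
  proof (intro prod_mono conjI)
    fix i assume "i \<in> {..<j}"
    then have "i < d" using assms by simp
    then show "0 \<le> (real d - real i) / (real N - real i)" using assms by simp
    show "(real d - real i) / (real N - real i) \<le> real d / real N"
      using hit_factor_antimono[of 0 i d N] \<open>i < d\<close> assms by simp
  qed
  then show ?thesis by simp
qed

lemma hit_add_le:
  assumes "a + b \<le> d" "d \<le> N"
  shows "hit N d (a + b) \<le> hit N d a * hit N d b"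
  using assms(1)
proof (induction b)
  case 0
  then show ?case by (simp add: hit_def)
next
  case (Suc b)
  let ?f = "\<lambda>i. (real d - real i) / (real N - real i)"
  have "hit N d (a + Suc b) = hit N d (a + b) * ?f (a + b)"
    by (simp add: hit_def)
  also have "\<dots> \<le> (hit N d a * hit N d b) * ?f b"
    using Suc assms(2) by (intro mult_mono hit_factor_antimono mult_nonneg_nonneg hit_nonneg) auto
  finally show ?case by (simp add: hit_def mult_ac)
qed

text \<open>A converse to the upper bounds: as long as at most half of the \<open>d\<close> places
  are used up, each factor is at least \<open>d / (2 * N)\<close>, so dropping \<open>j\<close>
  points gains at most \<open>2 * N / d\<close> for each.\<close>

lemma hit_le_hit_add:
  assumes "2 * (a + j) \<le> d" "d \<le> N"
  shows "hit N d a \<le> hit N d (a + j) * (2 * real N / real d) ^ j"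
  using assms(1)
proof (induction j)
  case 0
  then show ?case by simp
next
  case (Suc j)
  let ?i = "a + j"
  let ?f = "(real d - real ?i) / (real N - real ?i)"
  have d: "0 < d" "2 * real ?i \<le> real d" "real ?i < real N" using Suc.prems assms(2) by auto
  have "(real d / 2) / real N \<le> ?f"
  proof (rule frac_le)
    show "real d / 2 \<le> real d - real ?i" using d by simp
  qed (use d in auto)
  then have "(real d / 2) / real N * (2 * real N / real d) \<le> ?f * (2 * real N / real d)"
    by (rule mult_right_mono) simp
  then have f: "1 \<le> ?f * (2 * real N / real d)"
    using d assms(2) by simp
  have "hit N d a \<le> hit N d ?i * (2 * real N / real d) ^ j * 1"
    using Suc by simp
  also have "\<dots> \<le> hit N d ?i * (2 * real N / real d) ^ j * (?f * (2 * real N / real d))"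
    using Suc.prems assms(2) f by (intro mult_left_mono mult_nonneg_nonneg hit_nonneg) auto
  also have "\<dots> = hit N d (a + Suc j) * (2 * real N / real d) ^ Suc j"
    by (simp add: hit_def)
  finally show ?case .
qed

text \<open>Here \<open>2 * k - j\<close> is the size of the union of two \<open>k\<close>-sets with
  \<open>j\<close> common points. Compared with independence, each common point costs a factor
  \<open>2 * N / d\<close>; this controls the second moment.\<close>

lemma hit_union_le:
  assumes "j \<le> k" "2 * k \<le> d" "d \<le> N"
  shows "hit N d (2 * k - j) \<le> (hit N d k)\<^sup>2 * (2 * real N / real d) ^ j"
proof -
  have "hit N d (2 * k - j) \<le> hit N d k * hit N d (k - j)"
    using hit_add_le[of k "k - j" d N] assms by (simp add: mult_2)
  also have "\<dots> \<le> hit N d k * (hit N d k * (2 * real N / real d) ^ j)"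
    using hit_le_hit_add[of "k - j" j d N] assms by (intro mult_left_mono hit_nonneg) auto
  finally show ?thesis by (simp add: power2_eq_square mult_ac)
qed

section \<open>The second moment method for spread families\<close>

lemma sum_Pow_power_card:
  fixes x :: "'b::comm_semiring_1"
  assumes "finite A"
  shows "(\<Sum>B\<in>Pow A. x ^ card B) = (x + 1) ^ card A"
  using prod_add[OF assms, of "\<lambda>_. x" "\<lambda>_. 1"] by simp

text \<open>
  Chebyshev's inequality for the number of members of \<open>V\<close> contained in a random \<open>d\<close>-set: the
  hypothesis on \<open>V\<close> says that two random members of \<open>V\<close> hardly ever intersect.
\<close>

lemma density_avoiding_spread_le:
  fixes c :: real
  assumes X: "finite X" and V: "V \<subseteq> layer X k" "V \<noteq> {}" and c: "0 \<le> c"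
    and spread: "\<And>h. h \<subseteq> X \<Longrightarrow> real (card {v \<in> V. h \<subseteq> v}) \<le> real (card V) * c ^ card h"
    and d: "0 < d" "2 * k \<le> d" "d \<le> card X"
  shows "density X (\<lambda>T. \<forall>v\<in>V. \<not> v \<subseteq> T) d \<le> exp (2 * c * real k * real (card X) / real d) - 1"
proof -
  define N where "N = card X"
  define C where "C = real (N choose d)"
  \<comment> \<open>The cost of one common point in \<open>hit_union_le\<close>.\<close>
  define r where "r = 2 * real N / real d"
  define Z where "Z T = real (card {v \<in> V. v \<subseteq> T})" for T
  define p where "p = hit N d k"
  \<comment> \<open>The expectation of \<open>Z\<close> over the layer; sums over the layer are
    \<open>C\<close> times expectations.\<close>
  define \<mu> where "\<mu> = real (card V) * p"
  have finV: "finite V" using V(1) X finite_subset finite_layer by blast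
  have fv: "finite v" "card v = k" "v \<subseteq> X" if "v \<in> V" for v
    using that V(1) X by (auto simp: layer_def intro: finite_subset)
  have dN: "d \<le> N" using d by (simp add: N_def)
  have r1: "1 \<le> r" using d(1) dN by (simp add: r_def field_simps)
  have C: "0 < C" using dN by (simp add: C_def)
  have p: "0 < p" unfolding p_def using d dN by (intro hit_pos) auto
  have V0: "0 < card V" using finV V(2) by (simp add: card_gt_0_iff)
  have \<mu>: "0 < \<mu>" using V0 p by (simp add: \<mu>_def)
  have sup: "real (card {T \<in> layer X d. A \<subseteq> T}) = C * hit N d (card A)"
    if "A \<subseteq> X" "card A \<le> d" for A
    using card_layer_superset[OF X that] choose_diff_eq_hit[OF that(2) dN]
    by (simp add: C_def N_def)
  have Z_sum: "Z T = (\<Sum>v\<in>V. if v \<subseteq> T then 1 else 0)" for T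
    using finV by (simp add: Z_def sum.If_cases Int_def)
  have m1: "(\<Sum>T\<in>layer X d. Z T) = C * \<mu>"
  proof -
    have "(\<Sum>T\<in>layer X d. Z T) = (\<Sum>v\<in>V. \<Sum>T\<in>layer X d. if v \<subseteq> T then 1 else 0)"
      unfolding Z_sum by (rule sum.swap)
    also have "\<dots> = (\<Sum>v\<in>V. real (card {T \<in> layer X d. v \<subseteq> T}))"
      using X by (simp add: sum.If_cases Int_def)
    also have "\<dots> = (\<Sum>v\<in>V. C * p)"
      using fv d(2) by (intro sum.cong refl) (simp add: sup p_def)
    finally show ?thesis by (simp add: \<mu>_def)
  qed
  \<comment> \<open>Expanding \<open>r ^ card (v \<inter> w)\<close> over the subsets
    \<open>h\<close> of \<open>v \<inter> w\<close> and exchanging the sums leaves the number of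
    \<open>w\<close> containing \<open>h\<close>, which \<open>spread\<close> bounds. The sum over
    \<open>h\<close> is then again a binomial power.\<close>
  have inner: "(\<Sum>w\<in>V. r ^ card (v \<inter> w)) \<le> real (card V) * exp (r * c * real k)"
    if v: "v \<in> V" for v
  proof -
    have "(\<Sum>w\<in>V. r ^ card (v \<inter> w)) = (\<Sum>w\<in>V. \<Sum>h\<in>Pow v. if h \<subseteq> w then (r - 1) ^ card h else 0)"
    proof (rule sum.cong[OF refl])
      fix w
      have "r ^ card (v \<inter> w) = (\<Sum>h\<in>Pow (v \<inter> w). (r - 1) ^ card h)"
        using sum_Pow_power_card[of "v \<inter> w" "r - 1"] fv[OF v] by simp
      also have "\<dots> = (\<Sum>h\<in>Pow v \<inter> {h. h \<subseteq> w}. (r - 1) ^ card h)"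
        by (rule sum.cong) auto
      also have "\<dots> = (\<Sum>h\<in>Pow v. if h \<subseteq> w then (r - 1) ^ card h else 0)"
        using fv[OF v] by (simp add: sum.If_cases)
      finally show "r ^ card (v \<inter> w) = (\<Sum>h\<in>Pow v. if h \<subseteq> w then (r - 1) ^ card h else 0)" .
    qed
    also have "\<dots> = (\<Sum>h\<in>Pow v. \<Sum>w\<in>V. if h \<subseteq> w then (r - 1) ^ card h else 0)"
      by (rule sum.swap)
    also have "\<dots> = (\<Sum>h\<in>Pow v. real (card {w \<in> V. h \<subseteq> w}) * (r - 1) ^ card h)"
      using finV by (simp add: sum.If_cases Int_def)
    also have "\<dots> \<le> (\<Sum>h\<in>Pow v. real (card V) * c ^ card h * (r - 1) ^ card h)"
      using r1 fv[OF v] by (intro sum_mono mult_right_mono spread) auto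
    also have "\<dots> = real (card V) * (\<Sum>h\<in>Pow v. (c * (r - 1)) ^ card h)"
      by (simp add: sum_distrib_left power_mult_distrib mult_ac)
    also have "\<dots> = real (card V) * (c * (r - 1) + 1) ^ k"
      using fv[OF v] by (simp add: sum_Pow_power_card)
    also have "\<dots> \<le> real (card V) * exp (r * c) ^ k"
    proof (intro mult_left_mono power_mono)
      have "c * (r - 1) + 1 \<le> 1 + r * c" using c by (simp add: algebra_simps)
      also have "\<dots> \<le> exp (r * c)" by (rule exp_ge_add_one_self)
      finally show "c * (r - 1) + 1 \<le> exp (r * c)" .
    qed (use c r1 in auto)
    finally show ?thesis by (simp add: exp_of_nat2_mult)
  qed
  \<comment> \<open>The square of \<open>Z T\<close> counts ordered pairs whose union lies in
    \<open>T\<close>.\<close>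
  have m2: "(\<Sum>T\<in>layer X d. (Z T)\<^sup>2) \<le> C * \<mu>\<^sup>2 * exp (r * c * real k)"
  proof -
    have "(\<Sum>T\<in>layer X d. (Z T)\<^sup>2)
        = (\<Sum>T\<in>layer X d. \<Sum>v\<in>V. \<Sum>w\<in>V. if v \<union> w \<subseteq> T then 1 else 0)"
      unfolding Z_sum power2_eq_square sum_product by (intro sum.cong refl) auto
    also have "\<dots> = (\<Sum>v\<in>V. \<Sum>T\<in>layer X d. \<Sum>w\<in>V. if v \<union> w \<subseteq> T then 1 else 0)"
      by (rule sum.swap)
    also have "\<dots> = (\<Sum>v\<in>V. \<Sum>w\<in>V. \<Sum>T\<in>layer X d. if v \<union> w \<subseteq> T then 1 else 0)"
      by (intro sum.cong refl sum.swap)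
    also have "\<dots> = (\<Sum>v\<in>V. \<Sum>w\<in>V. real (card {T \<in> layer X d. v \<union> w \<subseteq> T}))"
      using X by (simp add: sum.If_cases Int_def)
    also have "\<dots> \<le> (\<Sum>v\<in>V. \<Sum>w\<in>V. C * (p\<^sup>2 * r ^ card (v \<inter> w)))"
    proof (intro sum_mono)
      fix v w assume v: "v \<in> V" and w: "w \<in> V"
      have un: "card (v \<union> w) = 2 * k - card (v \<inter> w)"
        using card_Un_Int[of v w] fv[OF v] fv[OF w] by simp
      have le: "card (v \<inter> w) \<le> k" using card_mono[of v "v \<inter> w"] fv[OF v] by simp
      have "real (card {T \<in> layer X d. v \<union> w \<subseteq> T}) = C * hit N d (2 * k - card (v \<inter> w))"
        using sup[of "v \<union> w"] un d(2) fv[OF v] fv[OF w] by simp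
      also have "\<dots> \<le> C * (p\<^sup>2 * r ^ card (v \<inter> w))"
        unfolding p_def r_def using C le d(2) dN by (intro mult_left_mono hit_union_le) auto
      finally show "real (card {T \<in> layer X d. v \<union> w \<subseteq> T}) \<le> C * (p\<^sup>2 * r ^ card (v \<inter> w))" .
    qed
    also have "\<dots> = C * p\<^sup>2 * (\<Sum>v\<in>V. \<Sum>w\<in>V. r ^ card (v \<inter> w))"
      by (simp add: sum_distrib_left mult_ac)
    also have "\<dots> \<le> C * p\<^sup>2 * (\<Sum>v\<in>V. real (card V) * exp (r * c * real k))"
      using C by (intro mult_left_mono sum_mono inner) auto
    also have "\<dots> = C * \<mu>\<^sup>2 * exp (r * c * real k)"
      by (simp add: \<mu>_def power2_eq_square mult_ac)
    finally show ?thesis .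
  qed
  let ?F = "{T \<in> layer X d. \<forall>v\<in>V. \<not> v \<subseteq> T}"
  \<comment> \<open>Chebyshev: a set avoiding \<open>V\<close> has \<open>Z T = 0\<close> and so
    contributes the full \<open>\<mu>\<^sup>2\<close> to the sum of squared deviations.\<close>
  have "real (card ?F) * \<mu>\<^sup>2 = (\<Sum>T\<in>?F. (Z T - \<mu>)\<^sup>2)"
  proof -
    have "Z T = 0" if "T \<in> ?F" for T
    proof -
      have "{v \<in> V. v \<subseteq> T} = {}" using that by auto
      then show ?thesis by (simp only: Z_def) simp
    qed
    then show ?thesis by simp
  qed
  also have "\<dots> \<le> (\<Sum>T\<in>layer X d. (Z T - \<mu>)\<^sup>2)"
    using X by (intro sum_mono2) auto
  also have "\<dots> = (\<Sum>T\<in>layer X d. (Z T)\<^sup>2) - 2 * \<mu> * (\<Sum>T\<in>layer X d. Z T) + C * \<mu>\<^sup>2"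
    using X by (simp add: power2_diff sum.distrib sum_subtractf sum_distrib_left card_layer
        C_def N_def mult_ac)
  also have "\<dots> \<le> C * \<mu>\<^sup>2 * exp (r * c * real k) - C * \<mu>\<^sup>2"
    using m2 by (simp add: m1 power2_eq_square algebra_simps)
  also have "\<dots> = C * (exp (r * c * real k) - 1) * \<mu>\<^sup>2"
    by (simp add: algebra_simps)
  finally have "real (card ?F) \<le> C * (exp (r * c * real k) - 1)"
    using \<mu> by simp
  then show ?thesis
    using C by (simp add: density_def C_def N_def r_def field_simps)
qed

section \<open>A maximal set with a dense link\<close>

lemma card_le_if_containing:
  assumes "U \<subseteq> msubsets n m" "containing U g \<noteq> {}"
  shows "card g \<le> m"
proof -
  obtain s where s: "s \<in> U" "g \<subseteq> s" using assms(2) by (auto simp: containing_def)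
  then have "s \<subseteq> {1..n}" "card s = m" using assms(1) by (auto simp: msubsets_def)
  then show ?thesis using s(2) card_mono[of s g] finite_subset[of s "{1..n}"] by simp
qed

text \<open>
  The generator is a largest \<open>g\<close> on whose link the relative density of \<open>U\<close> has gained a
  factor \<open>b ^ card g\<close>: the density cannot exceed 1, which bounds \<open>card g\<close>, and maximality makes
  the link spread.
\<close>

lemma exists_spread_link:
  fixes b :: real
  assumes U: "U \<subseteq> msubsets n m" "U \<noteq> {}" and b: "1 < b"
  obtains g where "g \<subseteq> {1..n}" "containing U g \<noteq> {}" "real (card g) \<le> sparsity n m U / ln b"
    "\<And>h. h \<subseteq> {1..n} - g \<Longrightarrow> real (card (containing U (g \<union> h)))
       \<le> real (card (containing U g)) * (b * real (m - card g) / real (n - card g)) ^ card h"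
proof -
  \<comment> \<open>The density gain with denominators cleared. Nonemptiness of the link must be
    required separately, since the inequality alone does not enter the bound
    \<open>card g \<le> m\<close>.\<close>
  define Q where "Q g \<longleftrightarrow> g \<subseteq> {1..n} \<and> containing U g \<noteq> {} \<and>
    b ^ card g * real (card U) * real ((n - card g) choose (m - card g))
      \<le> real (card (containing U g)) * real (n choose m)" for g
  have msub: "msubsets n m = layer {1..n} m" by (simp add: msubsets_def layer_def)
  have finU: "finite U" using U(1) unfolding msub by (rule finite_subset) simp
  have mn: "m \<le> n"
  proof -
    obtain s where "s \<subseteq> {1..n}" "card s = m" using U by (auto simp: msubsets_def)
    then show ?thesis using card_mono[of "{1..n}" s] by simp
  qed
  have U0: "0 < card U" using finU U(2) by (simp add: card_gt_0_iff)
  note gm = card_le_if_containing[OF U(1)]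
  have "Q {}" using U(2) by (simp add: Q_def containing_def)
  moreover have "\<forall>g. Q g \<longrightarrow> card g < Suc m" using gm by (simp add: Q_def less_Suc_eq_le)
  ultimately obtain g where Qg: "Q g" and max: "\<And>h. Q h \<Longrightarrow> card h \<le> card g"
    using ex_has_greatest_nat[of Q "{}" card "Suc m"] by blast
  define B where "B j = real ((n - j) choose (m - j))" for j
  have Bpos: "0 < B j" if "j \<le> m" for j using that mn by (simp add: B_def)
  have g: "g \<subseteq> {1..n}" "containing U g \<noteq> {}" "card g \<le> m"
    and gU: "b ^ card g * real (card U) * B (card g)
      \<le> real (card (containing U g)) * B 0"
    using Qg gm by (auto simp: Q_def B_def)
  have fing: "finite g" using g(1) finite_subset by blast
  show ?thesis
  proof (rule that[OF g(1,2)])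
    have "containing U g \<subseteq> {T \<in> layer {1..n} m. g \<subseteq> T}"
      using U(1) by (auto simp: containing_def msub)
    then have "card (containing U g) \<le> card {T \<in> layer {1..n} m. g \<subseteq> T}"
      by (intro card_mono) auto
    also have "\<dots> = (n - card g) choose (m - card g)"
      using card_layer_superset[of "{1..n}" g m] g by simp
    finally have "real (card (containing U g)) \<le> B (card g)" by (simp add: B_def)
    then have "real (card (containing U g)) * B 0 \<le> B (card g) * B 0"
      using Bpos[of 0] by (intro mult_right_mono) auto
    with gU have "(b ^ card g * real (card U)) * B (card g) \<le> B 0 * B (card g)"
      by (simp add: mult_ac)
    then have "b ^ card g * real (card U) \<le> B 0"
      using Bpos[OF g(3)] by (simp add: mult_le_cancel_right)
    then have "ln (b ^ card g * real (card U)) \<le> ln (B 0)"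
      using b U0 Bpos[of 0] by (intro ln_mono) auto
    then have "real (card g) * ln b + ln (real (card U)) \<le> ln (B 0)"
      using b U0 by (simp add: ln_mult ln_realpow)
    then show "real (card g) \<le> sparsity n m U / ln b"
      using b by (simp add: sparsity_def B_def field_simps)
  next
    fix h assume h: "h \<subseteq> {1..n} - g"
    define k N where "k = m - card g" and "N = n - card g"
    show "real (card (containing U (g \<union> h)))
       \<le> real (card (containing U g)) * (b * real (m - card g) / real (n - card g)) ^ card h"
    proof (cases "containing U (g \<union> h) = {} \<or> h = {}")
      case True
      then show ?thesis using b by auto
    next
      case False
      have finh: "finite h" using h finite_subset by blast
      have ch: "card (g \<union> h) = card g + card h"
        using h fing finh by (intro card_Un_disjoint) auto
      have "card h \<noteq> 0" using False finh by simp
      \<comment> \<open>Adding \<open>h\<close> contradicts maximality unless the density inequality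
        fails, as the link of \<open>g \<union> h\<close> is nonempty in this case.\<close>
      then have "\<not> Q (g \<union> h)" using max[of "g \<union> h"] ch by auto
      then have less: "real (card (containing U (g \<union> h))) * B 0
          < b ^ (card g + card h) * real (card U) * B (card g + card h)"
        using False g h by (auto simp: Q_def B_def ch)
      have chm: "card g + card h \<le> m" using gm[of "g \<union> h"] False ch by simp
      have "B (card g + card h) = real ((N - card h) choose (k - card h))"
        by (simp add: B_def N_def k_def)
      also have "\<dots> = real (N choose k) * hit N k (card h)"
        using chm mn by (intro choose_diff_eq_hit) (auto simp: N_def k_def)
      \<comment> \<open>The ratio of the binomials becomes a pure power, which combines with the
        \<open>card h\<close> extra factors \<open>b\<close> into the spread constant
        \<open>b * k / N\<close>.\<close>
      also have "\<dots> \<le> B (card g) * (real k / real N) ^ card h"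
        unfolding B_def N_def[symmetric] k_def[symmetric]
        using chm mn by (intro mult_left_mono hit_le_power) (auto simp: N_def k_def)
      finally have "b ^ (card g + card h) * real (card U) * B (card g + card h)
          \<le> b ^ (card g + card h) * real (card U) * (B (card g) * (real k / real N) ^ card h)"
        using b by (intro mult_left_mono) auto
      also have "\<dots> = (b ^ card g * real (card U) * B (card g)) * (b * real k / real N) ^ card h"
        by (simp add: power_add power_mult_distrib power_divide)
      also have "\<dots> \<le> (real (card (containing U g)) * B 0) * (b * real k / real N) ^ card h"
        using gU b by (intro mult_right_mono) auto
      finally have "real (card (containing U (g \<union> h))) * B 0
          \<le> (real (card (containing U g)) * (b * real k / real N) ^ card h) * B 0"
        using less by (simp add: mult_ac)
      then show ?thesis
        using Bpos[of 0] by (simp add: k_def N_def mult_le_cancel_right)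
    qed
  qed
qed

section \<open>The generator for fixed parameters\<close>

lemma exists_ext_generator:
  fixes lam \<epsilon> :: real
  assumes eps: "0 < \<epsilon>" "\<epsilon> \<le> 1 / 100" and lam: "1 \<le> lam" and m: "1 \<le> m"
    and U: "U \<subseteq> msubsets n m" "U \<noteq> {}" and ln: "l \<le> n"
    and l: "(real m)\<^sup>2 * lam / \<epsilon> < real l"
  shows "\<exists>g. ext_generator n m U l lam g \<and>
    real (card g) \<le> sparsity n m U / ln (\<epsilon> * real l / ((real m)\<^sup>2 * lam))"
proof -
  define b where "b = \<epsilon> * real l / ((real m)\<^sup>2 * lam)"
  have b: "1 < b" using l eps lam m by (simp add: b_def field_simps)
  obtain g where g: "g \<subseteq> {1..n}" "containing U g \<noteq> {}"
      and card_g: "real (card g) \<le> sparsity n m U / ln b"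
      and spread: "\<And>h. h \<subseteq> {1..n} - g \<Longrightarrow> real (card (containing U (g \<union> h)))
       \<le> real (card (containing U g)) * (b * real (m - card g) / real (n - card g)) ^ card h"
    using exists_spread_link[OF U b] by blast
  \<comment> \<open>Ground set and sizes after the removal of \<open>g\<close>; \<open>V\<close> is
    the link of \<open>g\<close> in \<open>U\<close>.\<close>
  define X k N L where "X = {1..n} - g" and "k = m - card g" and "N = n - card g"
    and "L = l - card g"
  define V where "V = (\<lambda>s. s - g) ` containing U g"
  have fing: "finite g" using g(1) finite_subset by blast
  have X: "finite X" "card X = N"
    using g(1) fing by (auto simp: X_def N_def card_Diff_subset)
  have inj: "inj_on (\<lambda>s. s - g) (containing U g)"
    by (auto simp: inj_on_def containing_def)
  have fins: "finite s" "card s = m" "s \<subseteq> {1..n}" if "s \<in> U" for s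
    using that U(1) by (auto simp: msubsets_def intro: finite_subset)
  have "s - g \<in> layer X k" if "s \<in> containing U g" for s
    using that fing fins[of s]
    by (auto simp: layer_def X_def k_def containing_def card_Diff_subset)
  then have V: "V \<subseteq> layer X k" "V \<noteq> {}"
    using g(2) by (auto simp: V_def)
  have card_V: "card V = card (containing U g)"
    unfolding V_def by (rule card_image[OF inj])
  have gm: "card g \<le> m" by (rule card_le_if_containing[OF U(1) g(2)])
  have V_spread: "real (card {v \<in> V. h \<subseteq> v}) \<le> real (card V) * (b * real k / real N) ^ card h"
    if h: "h \<subseteq> X" for h
  proof -
    have "{v \<in> V. h \<subseteq> v} = (\<lambda>s. s - g) ` containing U (g \<union> h)"
      using h by (auto simp: V_def containing_def X_def)
    moreover have "inj_on (\<lambda>s. s - g) (containing U (g \<union> h))"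
      by (auto simp: inj_on_def containing_def)
    ultimately have "card {v \<in> V. h \<subseteq> v} = card (containing U (g \<union> h))"
      by (simp add: card_image)
    then show ?thesis using spread[of h] h by (simp add: X_def k_def N_def card_V)
  qed

  have m1: "1 \<le> real m" using m by simp
  have m2: "real m \<le> (real m)\<^sup>2" using m by (simp add: power2_eq_square)
  have l_lam: "100 * (real m)\<^sup>2 < real l / lam"
  proof -
    have "100 * (real m)\<^sup>2 \<le> (real m)\<^sup>2 / \<epsilon>"
      using eps mult_right_mono[of \<epsilon> "1/100" "(real m)\<^sup>2"] by (simp add: field_simps)
    also have "\<dots> < real l / lam" using l lam by (simp add: field_simps)
    finally show ?thesis .
  qed
  have l_m: "100 * real m < real l"
  proof -
    have "real l / lam \<le> real l" using lam mult_right_mono[of 1 lam "real l"] by (simp add: field_simps)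
    then show ?thesis using l_lam m2 by linarith
  qed
  have gl: "card g < l" using gm l_m by linarith
  have LN: "L \<le> N" "0 < L" using ln gl by (auto simp: L_def N_def)
  \<comment> \<open>The number of independent blocks: at least \<open>lam\<close> for the final
    exponent, at most \<open>2 * lam\<close> to keep the block size \<open>d\<close> of order
    \<open>l / lam\<close>.\<close>
  define q where "q = nat \<lceil>lam\<rceil>"
  have q: "lam \<le> real q" "real q \<le> 2 * lam"
    using lam by (auto simp: q_def) linarith+
  have q0: "0 < q" using q lam by linarith
  define d where "d = L div q"
  have qd: "q * d \<le> L" by (simp add: d_def)
  have "real L < real q * (real d + 1)"
  proof -
    have "L < q * (d + 1)"
      using dividend_less_div_times[of q L] q0 by (simp add: d_def algebra_simps)
    then have "real L < real (q * (d + 1))" by (simp only: of_nat_less_iff)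
    then show ?thesis by (simp add: algebra_simps)
  qed
  also have "\<dots> \<le> 2 * lam * (real d + 1)"
    using q by (intro mult_right_mono) auto
  finally have "real L / lam < 2 * (real d + 1)"
    using lam by (simp add: field_simps)
  moreover have "99 / 100 * (real l / lam) \<le> real L / lam"
    using gm l_m gl lam by (simp add: L_def field_simps)
  \<comment> \<open>Roughly \<open>d > 0.495 * l / lam - 1\<close>, and the 1 is below
    \<open>0.01 * l / lam\<close> by \<open>l_lam\<close>.\<close>
  ultimately have d: "2 / 5 * (real l / lam) < real d"
    using l_lam m2 m1 by argo
  have d2: "2 * k \<le> d" "0 < d"
  proof -
    have "2 * real m < real d" using d l_lam m2 m1 by argo
    then show "2 * k \<le> d" "0 < d" by (auto simp: k_def)
  qed

  let ?P = "\<lambda>T. \<forall>v\<in>V. \<not> v \<subseteq> T"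
  have dN: "d \<le> N"
    using LN by (metis d_def div_le_dividend le_trans)
  have "density X ?P d \<le> exp (2 * (b * real k / real N) * real k * real (card X) / real d) - 1"
    using b dN d2 X by (intro density_avoiding_spread_le V V_spread) auto
  also have "\<dots> \<le> exp (1 / 4) - 1"
  proof -
    \<comment> \<open>\<open>N\<close> cancels, and the choice of \<open>b\<close> cancels
      \<open>m\<^sup>2\<close>. What is left is at most
      \<open>2 * (1 / 100) * (5 / 2) = 1 / 20\<close>.\<close>
    have "2 * (b * real k / real N) * real k * real (card X) / real d = 2 * b * (real k)\<^sup>2 / real d"
      using LN X by (simp add: power2_eq_square)
    also have "\<dots> \<le> 2 * b * (real m)\<^sup>2 / real d"
      using b by (intro divide_right_mono mult_left_mono power_mono) (auto simp: k_def)
    also have "\<dots> = 2 * \<epsilon> * (real l / lam) / real d"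
      using m lam by (simp add: b_def)
    also have "\<dots> \<le> 2 * (1 / 100) * (5 / 2 * real d) / real d"
    proof (intro divide_right_mono mult_mono)
      show "real l / lam \<le> 5 / 2 * real d" using d by argo
    qed (use eps lam in auto)
    also have "\<dots> \<le> 1 / 4" using d2 by simp
    finally show ?thesis by simp
  qed
  \<comment> \<open>Numerically,
    \<open>exp (1 / 4) - 1 \<le> 5 / 16 < 1 / 3 \<le> exp (- 1)\<close>.\<close>
  also have "\<dots> \<le> exp (- 1)"
  proof -
    have "exp (1 / 4 :: real) \<le> 1 + 1 / 4 + (1 / 4)\<^sup>2" by (rule exp_bound) auto
    moreover have "1 / 3 \<le> exp (- 1 :: real)"
      using exp_le by (simp add: exp_minus field_simps)
    ultimately show ?thesis by (simp add: power2_eq_square)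
  qed
  finally have dens_d: "density X ?P d \<le> exp (- 1)" .
  have "density X ?P L \<le> density X ?P (q * d)"
    using LN X qd by (intro density_antimono) auto
  also have "\<dots> \<le> density X ?P d ^ q"
    using LN X qd by (intro density_mult_le_power) auto
  also have "\<dots> \<le> exp (- 1) ^ q"
    by (intro power_mono dens_d density_nonneg)
  also have "\<dots> = exp (- real q)" by (simp flip: exp_of_nat_mult)
  also have "\<dots> \<le> exp (- lam)" using q by simp
  finally have "real (card {T \<in> layer X L. ?P T}) \<le> real (N choose L) * exp (- lam)"
    using LN X by (simp add: density_def field_simps)
  moreover have "card {T \<in> layer X L. \<not> ?P T} + card {T \<in> layer X L. ?P T} = N choose L"
  proof -
    have "card {T \<in> layer X L. \<not> ?P T} + card {T \<in> layer X L. ?P T}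
        = card ({T \<in> layer X L. \<not> ?P T} \<union> {T \<in> layer X L. ?P T})"
      using X by (intro card_Un_disjoint[symmetric]) auto
    also have "\<dots> = card (layer X L)" by (rule arg_cong[of _ _ card]) blast
    finally show ?thesis using X by (simp add: card_layer)
  qed
  ultimately have many: "real (N choose L) * (1 - exp (- lam)) \<le> real (card {T \<in> layer X L. \<not> ?P T})"
    by (simp add: algebra_simps flip: of_nat_add)
  \<comment> \<open>Adding \<open>g\<close> turns an \<open>L\<close>-set that contains a member of
    the link into an \<open>l\<close>-set that contains a member of \<open>U\<close> above
    \<open>g\<close>, injectively.\<close>
  have "card {T \<in> layer X L. \<not> ?P T} \<le> card (Ext n (containing U g) l)"
  proof (rule card_inj_on_le)
    show "inj_on (\<lambda>T. g \<union> T) {T \<in> layer X L. \<not> ?P T}"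
      by (auto simp: inj_on_def layer_def X_def)
    show "finite (Ext n (containing U g) l)"
      by (rule finite_subset[of _ "Pow {1..n}"]) (auto simp: Ext_def msubsets_def)
    show "(\<lambda>T. g \<union> T) ` {T \<in> layer X L. \<not> ?P T} \<subseteq> Ext n (containing U g) l"
    proof (rule image_subsetI)
      fix T assume T: "T \<in> {T \<in> layer X L. \<not> ?P T}"
      then have T': "finite T" "g \<inter> T = {}" "card T = L" "T \<subseteq> {1..n}"
        using X(1) by (auto simp: layer_def X_def intro: finite_subset)
      then have "card (g \<union> T) = l"
        using fing gl by (simp add: card_Un_disjoint L_def)
      moreover obtain s where "s \<in> containing U g" "s - g \<subseteq> T"
        using T by (auto simp: V_def)
      ultimately show "g \<union> T \<in> Ext n (containing U g) l"
        using g(1) T' by (auto simp: Ext_def msubsets_def)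
    qed
  qed
  with many have "ext_generator n m U l lam g"
    using g(1) l_m ln lam gl by (auto simp: ext_generator_def N_def L_def)
  then show ?thesis using card_g by (auto simp: b_def)
qed

section \<open>Passage to the asymptotic statement\<close>

theorem theorem3p4:
  "\<exists>\<epsilon>\<^sub>0::real. 0 < \<epsilon>\<^sub>0 \<and> \<epsilon>\<^sub>0 < 1 \<and>
    (\<forall>\<epsilon>::real. 0 < \<epsilon> \<and> \<epsilon> < \<epsilon>\<^sub>0 \<longrightarrow>
      (\<forall>(m :: nat \<Rightarrow> nat) (l :: nat \<Rightarrow> nat) (lam :: nat \<Rightarrow> real) (U :: nat \<Rightarrow> nat set set).
        (\<forall>\<^sub>F n in sequentially. m n \<in> {1..n}) \<and>
        (\<forall>\<^sub>F n in sequentially. U n \<subseteq> msubsets n (m n) \<and> U n \<noteq> {}) \<and>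
        (\<forall>\<^sub>F n in sequentially. 0 < lam n) \<and>
        much_less (\<lambda>n. 1) lam \<and>
        much_less lam (\<lambda>n. real n / (real (m n))\<^sup>2) \<and>
        (\<forall>\<^sub>F n in sequentially. l n \<in> {1..n}) \<and>
        (\<forall>\<^sub>F n in sequentially. real (l n) > (real (m n))\<^sup>2 * lam n / \<epsilon>)
        \<longrightarrow>
        (\<forall>\<^sub>F n in sequentially.
          \<exists>g. ext_generator n (m n) (U n) (l n) (lam n) g \<and>
              real (card g)
                \<le> sparsity n (m n) (U n) / ln (\<epsilon> * real (l n) / ((real (m n))\<^sup>2 * lam n)))))"
\<comment> \<open>The threshold is the absolute constant of
  \<open>exists_ext_generator\<close>.\<close>
proof (rule exI[of _ "1 / 100"], intro conjI allI impI; (elim conjE)?)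
  fix \<epsilon> :: real and m l :: "nat \<Rightarrow> nat" and lam :: "nat \<Rightarrow> real" and U :: "nat \<Rightarrow> nat set set"
  assume eps: "0 < \<epsilon>" "\<epsilon> < 1 / 100"
    and ev: "\<forall>\<^sub>F n in sequentially. m n \<in> {1..n}"
      "\<forall>\<^sub>F n in sequentially. U n \<subseteq> msubsets n (m n) \<and> U n \<noteq> {}"
      "\<forall>\<^sub>F n in sequentially. 0 < lam n"
      "\<forall>\<^sub>F n in sequentially. l n \<in> {1..n}"
      "\<forall>\<^sub>F n in sequentially. real (l n) > (real (m n))\<^sup>2 * lam n / \<epsilon>"
    and lim: "much_less (\<lambda>n. 1) lam"
  \<comment> \<open>Together with \<open>0 < lam n\<close> this gives \<open>1 \<le> lam n\<close>
    for large \<open>n\<close>.\<close>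
  have "\<forall>\<^sub>F n in sequentially. 1 / lam n < 1"
    using lim unfolding much_less_def by (rule order_tendstoD) simp
  with ev show "\<forall>\<^sub>F n in sequentially.
      \<exists>g. ext_generator n (m n) (U n) (l n) (lam n) g \<and>
          real (card g)
            \<le> sparsity n (m n) (U n) / ln (\<epsilon> * real (l n) / ((real (m n))\<^sup>2 * lam n))"
  proof eventually_elim
    case (elim n)
    then show ?case
      using eps by (intro exists_ext_generator) auto
  qed
qed auto

end
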